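(* For all integers $r,s\geq 1$, the grid $R_{r,s}$ satisfies $$\mathrm{gpn}(R_{r,s})=2\binom{r+s+2}{r+1}-2r-2s-4-\frac{rs}{2}\,(r+s+4).$$
   Context: For distinct vertices $u,v$ of a connected simple graph $G$, $\mathrm{gpn}_G(u,v)$ denotes the number of shortest $u$–$v$ paths in $G$, and for a graph $G$ on $n$ vertices $\mathrm{gpn}(G)=\sum_{\{u,v\}\subseteq V(G),\,u\neq v}\mathrm{gpn}_G(u,v)+n$ (sum over unordered pairs of distinct vertices). $R_{r,s}=P_r\,\square\,P_s$ is the Cartesian product of the paths $P_r$ and $P_s$ on $r$ and $s$ vertices; it has vertex set $\{1,\ldots,r\}\times\{1,\ldots,s\}$, with $(a,b)$ and $(x,y)$ adjacent if and only if $|a-x|+|b-y|=1$, and has $rs$ vertices. *)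

theory Defs
  imports Complex_Main "Graph_Theory.Graph_Theory"
begin

text \<open>
  Simple graphs are finite symmetric loop-free digraphs without parallel arcs
  (locale \<^locale>\<open>pair_graph\<close>); an edge joining two vertices is represented by the two
  opposite arcs between them.
\<close>

definition shortest_vpath :: "'a pair_pre_digraph \<Rightarrow> 'a \<Rightarrow> 'a \<Rightarrow> 'a list \<Rightarrow> bool" where
  "shortest_vpath G u v p \<longleftrightarrow>
     vpath p (with_proj G) \<and> hd p = u \<and> last p = v \<and>
     (\<forall>q. vpath q (with_proj G) \<and> hd q = u \<and> last q = v \<longrightarrow> vwalk_length p \<le> vwalk_length q)"

definition gpn_between :: "'a pair_pre_digraph \<Rightarrow> 'a \<Rightarrow> 'a \<Rightarrow> nat" where
  "gpn_between G u v = card {p. shortest_vpath G u v p}"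

text \<open>
  The sum over unordered pairs ranges over the two-element vertex sets. The description picks
  the common value of \<open>gpn_between G u v\<close> and \<open>gpn_between G v u\<close>; see
  \<open>gpn_between_unordered\<close> below.
\<close>

definition gpn :: "'a pair_pre_digraph \<Rightarrow> nat" where
  "gpn G = (\<Sum>e | e \<subseteq> pverts G \<and> card e = 2. THE n. \<exists>u v. e = {u, v} \<and> n = gpn_between G u v)
             + card (pverts G)"

definition path_graph :: "nat \<Rightarrow> nat pair_pre_digraph" where
  "path_graph n =
     \<lparr> pverts = {1..n},
       parcs = {(i, j). i \<in> {1..n} \<and> j \<in> {1..n} \<and> (j = Suc i \<or> i = Suc j)} \<rparr>"

definition cartesian_product ::
    "'a pair_pre_digraph \<Rightarrow> 'b pair_pre_digraph \<Rightarrow> ('a \<times> 'b) pair_pre_digraph" where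
  "cartesian_product G H =
     \<lparr> pverts = pverts G \<times> pverts H,
       parcs = {((a, b), (x, y)).
                  a = x \<and> a \<in> pverts G \<and> (b, y) \<in> parcs H \<or>
                  b = y \<and> b \<in> pverts H \<and> (a, x) \<in> parcs G} \<rparr>"

definition grid_graph :: "nat \<Rightarrow> nat \<Rightarrow> (nat \<times> nat) pair_pre_digraph" where
  "grid_graph r s = cartesian_product (path_graph r) (path_graph s)"


lemma vwalk_arcs_append:
  "xs \<noteq> [] \<Longrightarrow> ys \<noteq> [] \<Longrightarrow>
     vwalk_arcs (xs @ ys) = vwalk_arcs xs @ (last xs, hd ys) # vwalk_arcs ys"
proof (induction xs rule: vwalk_arcs.induct)
  case (2 x)
  then show ?case by (cases ys) auto
qed auto

lemma vwalk_arcs_rev: "vwalk_arcs (rev p) = rev (map prod.swap (vwalk_arcs p))"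
proof (induction p rule: vwalk_arcs.induct)
  case (3 x y xs)
  then show ?case using vwalk_arcs_append[of "rev xs @ [y]" "[x]"] by simp
qed auto

lemma vpath_rev:
  assumes "sym (parcs G)" "vpath p (with_proj G)"
  shows "vpath (rev p) (with_proj G)"
  using assms unfolding vpath_def vwalk_def by (auto simp: vwalk_arcs_rev dest: symD)

lemma shortest_vpath_rev:
  assumes "sym (parcs G)" "shortest_vpath G u v p"
  shows "shortest_vpath G v u (rev p)"
proof -
  have "vwalk_length (rev p) \<le> vwalk_length q"
    if "vpath q (with_proj G)" "hd q = v" "last q = u" for q
  proof -
    have "q \<noteq> []" using that(1) by (auto simp: vpath_def vwalk_def)
    then have "hd (rev q) = u" "last (rev q) = v" using that by (auto simp: hd_rev last_rev)
    then have "vwalk_length p \<le> vwalk_length (rev q)"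
      using assms vpath_rev[OF assms(1) that(1)] unfolding shortest_vpath_def by blast
    then show ?thesis by simp
  qed
  moreover have "p \<noteq> []" using assms(2) by (auto simp: shortest_vpath_def vpath_def vwalk_def)
  ultimately show ?thesis
    using assms vpath_rev unfolding shortest_vpath_def by (auto simp: hd_rev last_rev)
qed

lemma gpn_between_commute:
  assumes "sym (parcs G)"
  shows "gpn_between G u v = gpn_between G v u"
proof -
  have "bij_betw rev {p. shortest_vpath G u v p} {p. shortest_vpath G v u p}"
    by (rule bij_betwI[where g = rev]) (auto intro: shortest_vpath_rev[OF assms])
  then show ?thesis by (auto simp: gpn_between_def intro: bij_betw_same_card)
qed

lemma gpn_between_unordered:
  assumes "sym (parcs G)"
  shows "(THE n. \<exists>x y. {u, v} = {x, y} \<and> n = gpn_between G x y) = gpn_between G u v"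
  by (rule the_equality) (auto simp: doubleton_eq_iff gpn_between_commute[OF assms])

lemma pverts_grid_graph: "pverts (grid_graph r s) = {1..r} \<times> {1..s}"
  by (simp add: grid_graph_def cartesian_product_def path_graph_def)

lemma parcs_grid_graph:
  "((a, b), (x, y)) \<in> parcs (grid_graph r s) \<longleftrightarrow>
     (a, b) \<in> {1..r} \<times> {1..s} \<and> (x, y) \<in> {1..r} \<times> {1..s} \<and>
     \<bar>int a - int x\<bar> + \<bar>int b - int y\<bar> = 1"
  by (auto simp: grid_graph_def cartesian_product_def path_graph_def)

lemma pair_graph_grid_graph: "pair_graph (grid_graph r s)"
proof -
  have sub: "parcs (grid_graph r s) \<subseteq> ({1..r} \<times> {1..s}) \<times> ({1..r} \<times> {1..s})"
  proof (rule subsetI)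
    fix e assume "e \<in> parcs (grid_graph r s)"
    then show "e \<in> ({1..r} \<times> {1..s}) \<times> ({1..r} \<times> {1..s})"
      using parcs_grid_graph by (cases e; cases "fst e"; cases "snd e") auto
  qed
  have "finite (parcs (grid_graph r s))" using sub by (rule finite_subset) auto
  moreover have "sym (parcs (grid_graph r s))"
    by (rule symI) (auto simp: parcs_grid_graph)
  moreover have "fst e \<noteq> snd e" if "e \<in> parcs (grid_graph r s)" for e
    using that parcs_grid_graph by (cases e; cases "fst e"; cases "snd e") auto
  ultimately show ?thesis
    using sub by unfold_locales (auto simp: pverts_grid_graph symmetric_def)
qed

lemma connected_grid_graph:
  assumes "r \<ge> 1" "s \<ge> 1"
  shows "connected (with_proj (grid_graph r s))"
proof -
  interpret pair_graph "grid_graph r s" by (rule pair_graph_grid_graph)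
  let ?G = "with_proj (grid_graph r s)"
  have adj: "(a, b) \<rightarrow>\<^sup>*\<^bsub>?G\<^esub> (x, y)"
    if "((a, b), (x, y)) \<in> parcs (grid_graph r s)" for a b x y
    using that by (intro reachable_adjI) simp
  have row: "1 \<le> a \<Longrightarrow> a \<le> r \<Longrightarrow> (1, 1) \<rightarrow>\<^sup>*\<^bsub>?G\<^esub> (a, 1)" for a
  proof (induction a rule: dec_induct)
    case base
    then show ?case using assms by (intro reachable_refl) (simp add: pverts_grid_graph)
  next
    case (step n)
    have "(n, 1) \<rightarrow>\<^sup>*\<^bsub>?G\<^esub> (Suc n, 1)"
      using step assms by (intro adj) (simp add: parcs_grid_graph)
    then show ?case using step reachable_trans by (meson Suc_leD)
  qed
  have col: "1 \<le> b \<Longrightarrow> b \<le> s \<Longrightarrow> (1, 1) \<rightarrow>\<^sup>*\<^bsub>?G\<^esub> (a, b)" if "1 \<le> a" "a \<le> r" for a b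
  proof (induction b rule: dec_induct)
    case base
    then show ?case using row that by blast
  next
    case (step n)
    have "(a, n) \<rightarrow>\<^sup>*\<^bsub>?G\<^esub> (a, Suc n)"
      using step that by (intro adj) (simp add: parcs_grid_graph)
    then show ?case using step reachable_trans by (meson Suc_leD)
  qed
  have "u \<rightarrow>\<^sup>*\<^bsub>?G\<^esub> v" if "u \<in> verts ?G" "v \<in> verts ?G" for u v
  proof -
    have "(1, 1) \<rightarrow>\<^sup>*\<^bsub>?G\<^esub> u" "(1, 1) \<rightarrow>\<^sup>*\<^bsub>?G\<^esub> v"
      using that col by (cases u; cases v; auto simp: pverts_grid_graph)+
    then show ?thesis
      using symmetric_reachable[OF sym_arcs] reachable_trans by blast
  qed
  moreover have "verts ?G \<noteq> {}" using assms by (auto simp: pverts_grid_graph)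
  ultimately show ?thesis
    by (auto simp: connected_def intro!: strongly_connectedI reachable_mk_symmetricI)
qed

end

theory Submission
  imports Defs
begin

text \<open>
  The graph distance in the grid is the Manhattan distance, and the first edge of a shortest path
  decreases one of the two coordinate differences by one. Pascal's rule then gives
  $\binom{i+j}{i}$ shortest paths between vertices with coordinate differences $i$ and $j$.
  Summing over all ordered pairs counts every unordered pair twice and every vertex once.
  In this sum a coordinate difference $d > 0$ occurs for $2(r-d)$ pairs and $d = 0$ for $r$
  pairs in $\{1,\ldots,r\}^2$, and the weighted binomial sums that remain follow from the hockey
  stick identity.
\<close>

text \<open>One of the two truncated differences is 0, so this is $|a - x|$.\<close>
definition ndist :: "nat \<Rightarrow> nat \<Rightarrow> nat" where
  "ndist a x = (a - x) + (x - a)"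

definition grid_dist :: "nat \<times> nat \<Rightarrow> nat \<times> nat \<Rightarrow> nat" where
  "grid_dist u v = ndist (fst u) (fst v) + ndist (snd u) (snd v)"

text \<open>The value at \<open>a = x\<close> is a default; every use has
  \<open>a \<noteq> x\<close>.\<close>

definition step_towards :: "nat \<Rightarrow> nat \<Rightarrow> nat" where
  "step_towards a x = (if a < x then Suc a else a - 1)"

text \<open>Walks of the exact length, rather than shortest paths: removing the first vertex again
  gives such a walk, with no distinctness or minimality to carry through the recursion.
  \<open>length\<close> counts vertices, hence the \<open>Suc\<close>.\<close>

definition geodesics ::
    "nat \<Rightarrow> nat \<Rightarrow> nat \<times> nat \<Rightarrow> nat \<times> nat \<Rightarrow> (nat \<times> nat) list set" where
  "geodesics r s u v =
     {p. vwalk p (with_proj (grid_graph r s)) \<and> hd p = u \<and> last p = v \<and>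
         length p = Suc (grid_dist u v)}"

text \<open>Successor equations in place of absolute values fit the truncated differences in
  \<open>ndist\<close>.\<close>

lemma parcs_grid_graph_cases:
  "((a, b), (x, y)) \<in> parcs (grid_graph r s) \<longleftrightarrow>
     (a, b) \<in> {1..r} \<times> {1..s} \<and> (x, y) \<in> {1..r} \<times> {1..s} \<and>
     (a = x \<and> (b = Suc y \<or> y = Suc b) \<or> b = y \<and> (a = Suc x \<or> x = Suc a))"
  unfolding parcs_grid_graph by (intro conj_cong refl) arith

section \<open>Distance bound for walks\<close>

lemma grid_dist_arc:
  assumes "(u, v) \<in> parcs (grid_graph r s)"
  shows "grid_dist u w \<le> Suc (grid_dist v w)"
proof -
  obtain a b x y where "u = (a, b)" "v = (x, y)" by fastforce
  then show ?thesis using assms by (auto simp: parcs_grid_graph_cases grid_dist_def ndist_def)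
qed

lemma grid_dist_le_vwalk:
  assumes "vwalk p (with_proj (grid_graph r s))"
  shows "Suc (grid_dist (hd p) (last p)) \<le> length p"
  using assms
proof (induction p)
  case (Base u)
  then show ?case by (simp add: grid_dist_def ndist_def)
next
  case (Cons u v es)
  have "grid_dist u (last (v # es)) \<le> Suc (grid_dist v (last (v # es)))"
    using Cons.hyps by (intro grid_dist_arc) simp
  then show ?case using Cons.IH by simp
qed

text \<open>No new arc arises: the arc into \<open>y\<close> comes from its first visit, the arcs
  after \<open>y\<close> from its second.\<close>

lemma vwalk_shortcut:
  assumes "vwalk (xs @ y # ys @ y # zs) G"
  shows "vwalk (xs @ y # zs) G"
proof -
  have "set (vwalk_arcs (y # zs)) \<subseteq> set (vwalk_arcs (xs @ y # ys @ y # zs))"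
    using set_vwalk_arcs_append2[of "y # zs" "xs @ y # ys"] by simp
  moreover have "set (vwalk_arcs xs) \<subseteq> set (vwalk_arcs (xs @ y # ys @ y # zs))"
    by (rule set_vwalk_arcs_append1)
  moreover have "xs \<noteq> [] \<Longrightarrow> (last xs, y) \<in> set (vwalk_arcs (xs @ y # ys @ y # zs))"
    by (subst Vertex_Walk.vwalk_arcs_append) auto
  ultimately have "set (vwalk_arcs (xs @ y # zs)) \<subseteq> set (vwalk_arcs (xs @ y # ys @ y # zs))"
    by (cases "xs = []") (auto simp: Vertex_Walk.vwalk_arcs_append simp del: vwalk_arcs_Cons)
  then show ?thesis using assms unfolding vwalk_def by auto
qed

text \<open>Cutting out the piece between two visits of a vertex would leave a walk shorter than the
  distance.\<close>

lemma geodesic_distinct: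
  assumes "p \<in> geodesics r s u v"
  shows "distinct p"
proof (rule ccontr)
  assume "\<not> distinct p"
  then obtain xs ys zs y where p: "p = xs @ y # ys @ y # zs"
    using not_distinct_decomp by fastforce
  let ?q = "xs @ y # zs"
  have "hd ?q = u" "last ?q = v"
    using assms by (cases xs; simp add: p geodesics_def)+
  moreover have "vwalk ?q (with_proj (grid_graph r s))"
    using assms by (intro vwalk_shortcut[of xs y ys zs]) (simp add: geodesics_def p)
  ultimately have "Suc (grid_dist u v) \<le> length ?q"
    using grid_dist_le_vwalk[of ?q r s] by (simp only:)
  then show False using assms by (simp add: geodesics_def p)
qed

section \<open>Counting geodesics by their first step\<close>

lemma Cons_geodesics_iff:
  assumes "u \<noteq> v"
  shows "u # p \<in> geodesics r s u v \<longleftrightarrow>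
    (\<exists>w. (u, w) \<in> parcs (grid_graph r s) \<and> p \<in> geodesics r s w v \<and>
         grid_dist u v = Suc (grid_dist w v))"
proof (cases p)
  case Nil
  then show ?thesis using assms by (simp add: geodesics_def)
next
  case (Cons w q)
  have walk: "vwalk (u # p) (with_proj (grid_graph r s)) \<longleftrightarrow>
      (u, w) \<in> parcs (grid_graph r s) \<and> vwalk p (with_proj (grid_graph r s))"
  proof -
    have "u \<in> {1..r} \<times> {1..s}" if "(u, w) \<in> parcs (grid_graph r s)"
      using that parcs_grid_graph by (cases u; cases w) blast
    then show ?thesis by (auto simp: Cons vwalk_def pverts_grid_graph)
  qed
  \<comment> \<open>The distance must drop: one arc lowers it by at most one, and the remaining walk
    is at least as long as the distance from \<open>w\<close>.\<close>
  have "grid_dist u v = Suc (grid_dist w v)"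
    if "u # p \<in> geodesics r s u v"
  proof (rule antisym)
    show "grid_dist u v \<le> Suc (grid_dist w v)"
      using that walk by (intro grid_dist_arc[of _ _ r s]) (simp add: geodesics_def)
    show "Suc (grid_dist w v) \<le> grid_dist u v"
      using that walk grid_dist_le_vwalk[of p r s] Cons by (simp add: geodesics_def)
  qed
  moreover have "p \<in> geodesics r s w' v \<Longrightarrow> w' = w" for w'
    by (simp add: geodesics_def Cons)
  moreover have "u # p \<in> geodesics r s u v \<longleftrightarrow>
      (u, w) \<in> parcs (grid_graph r s) \<and> p \<in> geodesics r s w v"
    if "grid_dist u v = Suc (grid_dist w v)"
    using that walk by (auto simp: geodesics_def Cons)
  ultimately show ?thesis by blast
qed

text \<open>A neighbour is closer exactly if the coordinate that changes moves towards its target;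
  it then stays between two coordinates of the rectangle, so the arc exists.\<close>

lemma grid_closer_arc_iff:
  assumes "(a, b) \<in> {1..r} \<times> {1..s}" "(x, y) \<in> {1..r} \<times> {1..s}"
  shows "((a, b), w) \<in> parcs (grid_graph r s) \<and>
           grid_dist (a, b) (x, y) = Suc (grid_dist w (x, y)) \<longleftrightarrow>
         a \<noteq> x \<and> w = (step_towards a x, b) \<or> b \<noteq> y \<and> w = (a, step_towards b y)"
proof -
  obtain c d where w: "w = (c, d)" by fastforce
  show ?thesis
    using assms unfolding w parcs_grid_graph_cases
    by (auto simp: grid_dist_def ndist_def step_towards_def)
qed

lemma geodesics_self:
  assumes "u \<in> {1..r} \<times> {1..s}"
  shows "geodesics r s u u = {[u]}"
  using assms
  by (auto simp: geodesics_def grid_dist_def ndist_def vwalk_def pverts_grid_graph length_Suc_conv)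

lemma geodesics_step:
  assumes "(a, b) \<in> {1..r} \<times> {1..s}" "(x, y) \<in> {1..r} \<times> {1..s}" "(a, b) \<noteq> (x, y)"
  shows "geodesics r s (a, b) (x, y) = (#) (a, b) `
    ((if a = x then {} else geodesics r s (step_towards a x, b) (x, y)) \<union>
     (if b = y then {} else geodesics r s (a, step_towards b y) (x, y)))"
    (is "?L = (#) (a, b) ` ?R")
proof -
  have R: "(a, b) # p \<in> ?L \<longleftrightarrow> p \<in> ?R" for p
  proof -
    have "(a, b) # p \<in> ?L \<longleftrightarrow>
        (\<exists>w. (a \<noteq> x \<and> w = (step_towards a x, b) \<or> b \<noteq> y \<and> w = (a, step_towards b y)) \<and>
             p \<in> geodesics r s w (x, y))"
      unfolding Cons_geodesics_iff[OF assms(3)] grid_closer_arc_iff[OF assms(1,2), symmetric]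
      by blast
    then show ?thesis by auto
  qed
  \<comment> \<open>The length condition excludes the empty list, so comparing lists that start with
    \<open>(a, b)\<close> suffices.\<close>
  have "\<exists>p. q = (a, b) # p" if "q \<in> ?L" for q
    using that by (cases q) (auto simp: geodesics_def)
  then show ?thesis using R by blast
qed

lemma geodesics_disjoint:
  "u \<noteq> v \<Longrightarrow> geodesics r s u w \<inter> geodesics r s v w = {}"
  by (auto simp: geodesics_def)

text \<open>Induction on the distance with the target fixed. Finiteness is carried along because the
  cardinality of the disjoint union requires it.\<close>

lemma finite_card_geodesics:
  assumes "(a, b) \<in> {1..r} \<times> {1..s}" "(x, y) \<in> {1..r} \<times> {1..s}"
  shows "finite (geodesics r s (a, b) (x, y)) \<and>
    card (geodesics r s (a, b) (x, y)) = (ndist a x + ndist b y) choose ndist a x"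
  using assms(1)
proof (induction "grid_dist (a, b) (x, y)" arbitrary: a b rule: less_induct)
  case less
  let ?a = "step_towards a x" and ?b = "step_towards b y"
  have IHa: "finite (geodesics r s (?a, b) (x, y)) \<and>
      card (geodesics r s (?a, b) (x, y)) = (ndist ?a x + ndist b y) choose ndist ?a x" if "a \<noteq> x"
    using less.prems assms(2) that
    by (intro less.hyps) (auto simp: grid_dist_def ndist_def step_towards_def)
  have IHb: "finite (geodesics r s (a, ?b) (x, y)) \<and>
      card (geodesics r s (a, ?b) (x, y)) = (ndist a x + ndist ?b y) choose ndist a x" if "b \<noteq> y"
    using less.prems assms(2) that
    by (intro less.hyps) (auto simp: grid_dist_def ndist_def step_towards_def)
  have da: "ndist a x = Suc (ndist ?a x)" if "a \<noteq> x"
    using that by (auto simp: ndist_def step_towards_def)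
  have db: "ndist b y = Suc (ndist ?b y)" if "b \<noteq> y"
    using that by (auto simp: ndist_def step_towards_def)
  have d0: "ndist z z = 0" for z
    by (simp add: ndist_def)
  note step = geodesics_step[OF less.prems assms(2)]
  consider "a = x" "b = y" | "a \<noteq> x" "b = y" | "a = x" "b \<noteq> y" | "a \<noteq> x" "b \<noteq> y"
    by blast
  then show ?case
  proof cases
    case 1
    then show ?thesis using geodesics_self[OF less.prems] by (simp add: d0)
  next
    case 2
    then show ?thesis using step IHa da by (simp add: card_image d0)
  next
    case 3
    then show ?thesis using step IHb db by (simp add: card_image d0)
  next
    case 4
    have disj: "geodesics r s (?a, b) (x, y) \<inter> geodesics r s (a, ?b) (x, y) = {}"
      using 4(1) by (intro geodesics_disjoint) (auto simp: step_towards_def)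
    \<comment> \<open>With differences \<open>Suc i\<close> and \<open>Suc j\<close>, the two parts
      have \<open>(i + Suc j) choose i\<close> and \<open>(Suc i + j) choose Suc i\<close> elements;
      Pascal's rule adds them.\<close>
    show ?thesis
      using 4 step IHa IHb da db by (simp add: card_image card_Un_disjoint[OF _ _ disj])
  qed
qed

lemma gpn_between_grid_graph:
  assumes "(a, b) \<in> {1..r} \<times> {1..s}" "(x, y) \<in> {1..r} \<times> {1..s}"
  shows "gpn_between (grid_graph r s) (a, b) (x, y) = (ndist a x + ndist b y) choose ndist a x"
proof -
  note fc = finite_card_geodesics[OF assms]
  \<comment> \<open>The binomial is positive, so some \<open>q\<close> attains the lower bound, and
    every shortest path can be compared with it.\<close>
  have "card (geodesics r s (a, b) (x, y)) \<noteq> 0" using fc by simp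
  then obtain q where q: "q \<in> geodesics r s (a, b) (x, y)"
    by (metis card.empty ex_in_conv)
  have geo: "vpath p (with_proj (grid_graph r s)) \<and> hd p = (a, b) \<and> last p = (x, y) \<and>
      length p = Suc (grid_dist (a, b) (x, y))" if "p \<in> geodesics r s (a, b) (x, y)" for p
    using that geodesic_distinct[OF that] by (simp add: geodesics_def vpath_def)
  have lower: "Suc (grid_dist (a, b) (x, y)) \<le> length p"
    if "vpath p (with_proj (grid_graph r s))" "hd p = (a, b)" "last p = (x, y)" for p
    using that grid_dist_le_vwalk[of p r s] by (auto simp: vpath_def)
  have "shortest_vpath (grid_graph r s) (a, b) (x, y) p \<longleftrightarrow> p \<in> geodesics r s (a, b) (x, y)" for p
  proof
    assume "shortest_vpath (grid_graph r s) (a, b) (x, y) p"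
    then have p: "vpath p (with_proj (grid_graph r s))" "hd p = (a, b)" "last p = (x, y)"
      and "length p - 1 \<le> length q - 1"
      using geo[OF q] unfolding shortest_vpath_def vwalk_length_simp by blast+
    moreover have "length q = Suc (grid_dist (a, b) (x, y))"
      using geo[OF q] by blast
    ultimately have "length p = Suc (grid_dist (a, b) (x, y))"
      using lower[OF p] by linarith
    then show "p \<in> geodesics r s (a, b) (x, y)"
      using p unfolding geodesics_def vpath_def by blast
  next
    assume "p \<in> geodesics r s (a, b) (x, y)"
    from geo[OF this] show "shortest_vpath (grid_graph r s) (a, b) (x, y) p"
      unfolding shortest_vpath_def vwalk_length_simp using lower by (metis diff_le_mono)
  qed
  then show ?thesis using fc by (simp add: gpn_between_def)
qed

section \<open>Ordered and unordered pairs\<close>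

lemma sum_ordered_pairs:
  fixes f :: "'a \<Rightarrow> 'a \<Rightarrow> nat"
  assumes "finite A" and sym: "\<And>u v. f u v = f v u"
  shows "(\<Sum>u\<in>A. \<Sum>v\<in>A. f u v) =
    2 * (\<Sum>e | e \<subseteq> A \<and> card e = 2. THE n. \<exists>u v. e = {u, v} \<and> n = f u v) + (\<Sum>u\<in>A. f u u)"
proof -
  let ?E = "{e. e \<subseteq> A \<and> card e = 2}"
  let ?P = "{z \<in> A \<times> A. fst z \<noteq> snd z}"
  let ?e = "\<lambda>z. {fst z, snd z}"
  have "(\<Sum>u\<in>A. \<Sum>v\<in>A. f u v) = (\<Sum>z\<in>A \<times> A. f (fst z) (snd z))"
    by (simp add: sum.cartesian_product split_beta)
  also have "A \<times> A = ?P \<union> (\<lambda>u. (u, u)) ` A" by auto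
  also have "(\<Sum>z\<in>?P \<union> (\<lambda>u. (u, u)) ` A. f (fst z) (snd z)) =
      (\<Sum>z\<in>?P. f (fst z) (snd z)) + (\<Sum>u\<in>A. f u u)"
    using assms(1) by (subst sum.union_disjoint) (auto simp: sum.reindex inj_on_def)
  \<comment> \<open>Ordered pairs are grouped by their underlying set; each fibre has two pairs, of
    equal value by symmetry.\<close>
  also have "(\<Sum>z\<in>?P. f (fst z) (snd z)) = (\<Sum>e\<in>?E. \<Sum>z | z \<in> ?P \<and> ?e z = e. f (fst z) (snd z))"
    using assms(1) by (intro sum.group[symmetric]) auto
  also have "\<dots> = (\<Sum>e\<in>?E. 2 * (THE n. \<exists>u v. e = {u, v} \<and> n = f u v))"
  proof (rule sum.cong[OF refl])
    fix e assume e: "e \<in> ?E"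
    then obtain u v where uv: "e = {u, v}" "u \<noteq> v" by (auto simp: card_2_iff)
    have "{z. z \<in> ?P \<and> ?e z = e} = {(u, v), (v, u)}"
      using uv e by (auto simp: doubleton_eq_iff)
    moreover have "(THE n. \<exists>x y. e = {x, y} \<and> n = f x y) = f u v"
      using uv by (intro the_equality) (auto simp: doubleton_eq_iff sym)
    ultimately show "(\<Sum>z | z \<in> ?P \<and> ?e z = e. f (fst z) (snd z)) =
        2 * (THE n. \<exists>u v. e = {u, v} \<and> n = f u v)"
      using uv sym[of u v] by simp
  qed
  finally show ?thesis by (simp add: sum_distrib_left)
qed

section \<open>Weighted binomial sums\<close>

lemma sum_diff_Suc:
  fixes f :: "nat \<Rightarrow> real"
  shows "(\<Sum>e<Suc s. real (Suc s - e) * f e) = (\<Sum>e<s. real (s - e) * f e) + (\<Sum>e<Suc s. f e)"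
proof -
  \<comment> \<open>Each weight grows by one; the new index \<open>e = s\<close> has weight
    \<open>s - s = 0\<close> and drops out of the first sum.\<close>
  have "real (Suc s - e) * f e = real (s - e) * f e + f e" if "e < Suc s" for e
    using that by (simp add: Suc_diff_le algebra_simps)
  then show ?thesis by (simp add: sum.distrib)
qed

text \<open>The doubled sum gives \<open>d = 0\<close> the weight \<open>2 * r\<close> instead of
  \<open>r\<close>, hence the correction. The induction adds a row, a column and their common
  corner.\<close>

lemma sum_ndist:
  fixes f :: "nat \<Rightarrow> real"
  shows "(\<Sum>a=1..r. \<Sum>x=1..r. f (ndist a x)) = 2 * (\<Sum>d<r. real (r - d) * f d) - real r * f 0"
proof (induction r)
  case (Suc r)
  have refl: "(\<Sum>x=1..r. f (ndist (Suc r) x)) = (\<Sum>d<r. f (Suc d))"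
    by (rule sum.reindex_bij_witness[of _ "\<lambda>d. r - d" "\<lambda>x. r - x"]) (auto simp: ndist_def Suc_diff_le)
  have comm: "(\<Sum>a=1..r. f (ndist a (Suc r))) = (\<Sum>x=1..r. f (ndist (Suc r) x))"
    by (simp add: ndist_def add.commute)
  have diag: "ndist (Suc r) (Suc r) = 0"
    by (simp add: ndist_def)
  have "(\<Sum>a=1..Suc r. \<Sum>x=1..Suc r. f (ndist a x)) =
      (\<Sum>a=1..r. \<Sum>x=1..r. f (ndist a x)) + 2 * (\<Sum>d<r. f (Suc d)) + f 0"
    using refl comm by (simp add: sum.distrib diag)
  moreover have "(\<Sum>d<Suc r. f d) = f 0 + (\<Sum>d<r. f (Suc d))"
    by (rule sum.lessThan_Suc_shift)
  ultimately show ?case unfolding sum_diff_Suc using Suc.IH by (simp add: algebra_simps)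
qed simp

lemma sum_choose_column:
  "(\<Sum>e<s. real ((d + e) choose d)) = real ((d + s) choose Suc d)"
  by (induction s) simp_all

text \<open>A second hockey stick summation: by \<open>sum_diff_Suc\<close> the increment in
  \<open>s\<close> is a plain column sum.\<close>

lemma sum_weighted_choose_column:
  "(\<Sum>e<s. real (s - e) * real ((d + e) choose d)) = real ((d + s + 1) choose (d + 2))"
proof (induction s)
  case (Suc s)
  then show ?case unfolding sum_diff_Suc sum_choose_column by simp
qed (simp add: binomial_eq_0)

text \<open>Hockey stick along a diagonal; the subtracted \<open>1\<close> and \<open>s\<close> are
  its entries with lower index 0 and 1, which the sum omits.\<close>

lemma sum_choose_diagonal:
  "(\<Sum>d<r. real ((d + s + 1) choose (d + 2))) = real ((r + s + 1) choose (r + 1)) - real s - 1"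
  by (induction r) simp_all

lemma sum_weighted_choose:
  "(\<Sum>d<r. real (r - d) * (\<Sum>e<s. real (s - e) * real ((d + e) choose d))) =
     real ((r + s + 2) choose (r + 1)) - real (r + 1) * real (s + 1) - 1"
  unfolding sum_weighted_choose_column
proof (induction r)
  case (Suc r)
  then show ?case unfolding sum_diff_Suc sum_choose_diagonal by (simp add: algebra_simps)
qed simp

lemma sum_diff_lessThan: "(\<Sum>d<r. real (r - d)) = real r * (real r + 1) / 2"
proof (induction r)
  case (Suc r)
  have "(\<Sum>d<Suc r. real (Suc r - d)) = (\<Sum>d<r. real (r - d)) + real (Suc r)"
    using sum_diff_Suc[of r "\<lambda>_. 1"] by simp
  then show ?case unfolding Suc.IH by (simp add: field_simps)
qed simp

lemma sum_ordered_choose: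
  "(\<Sum>a=1..r. \<Sum>x=1..r. \<Sum>b=1..s. \<Sum>y=1..s. real ((ndist a x + ndist b y) choose ndist a x)) =
     4 * real ((r + s + 2) choose (r + 1)) - 4 * real (r + s + 2) - real (r * s) * real (r + s + 5)"
proof -
  \<comment> \<open>The sum over the second coordinates for a fixed first difference
    \<open>d\<close>; \<open>sum_ndist\<close> is applied to these coordinates and then to the first
    ones.\<close>
  let ?g = "\<lambda>d. 2 * (\<Sum>e<s. real (s - e) * real ((d + e) choose d)) - real s"
  have "(\<Sum>b=1..s. \<Sum>y=1..s. real ((d + ndist b y) choose d)) = ?g d" for d
    using sum_ndist[of "\<lambda>e. real ((d + e) choose d)" s] by simp
  then have "(\<Sum>a=1..r. \<Sum>x=1..r. \<Sum>b=1..s. \<Sum>y=1..s.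
        real ((ndist a x + ndist b y) choose ndist a x)) = (\<Sum>a=1..r. \<Sum>x=1..r. ?g (ndist a x))"
    by simp
  also have "\<dots> = 2 * (\<Sum>d<r. real (r - d) * ?g d) - real r * ?g 0"
    by (rule sum_ndist)
  also have "(\<Sum>d<r. real (r - d) * ?g d) =
      2 * (\<Sum>d<r. real (r - d) * (\<Sum>e<s. real (s - e) * real ((d + e) choose d)))
        - real s * (\<Sum>d<r. real (r - d))"
    by (simp add: right_diff_distrib sum_subtractf sum_distrib_left mult_ac)
  also have "?g 0 = 2 * (\<Sum>e<s. real (s - e)) - real s" by simp
  finally show ?thesis
    unfolding sum_weighted_choose sum_diff_lessThan by (simp add: field_simps)
qed

theorem proposition5:
  fixes r s :: nat
  assumes "r \<ge> 1" and "s \<ge> 1"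
  shows "real (gpn (grid_graph r s)) =
           2 * real ((r + s + 2) choose (r + 1)) - 2 * real r - 2 * real s - 4
             - real (r * s) / 2 * real (r + s + 4)"
proof -
  let ?G = "grid_graph r s" and ?V = "{1..r} \<times> {1..s}"
  interpret pair_graph ?G by (rule pair_graph_grid_graph)
  have "sym (parcs ?G)" using sym_arcs by (simp add: symmetric_def)
  then have "(\<Sum>u\<in>?V. \<Sum>v\<in>?V. gpn_between ?G u v) =
      2 * (\<Sum>e | e \<subseteq> ?V \<and> card e = 2. THE n. \<exists>u v. e = {u, v} \<and> n = gpn_between ?G u v)
        + (\<Sum>u\<in>?V. gpn_between ?G u u)"
    by (intro sum_ordered_pairs gpn_between_commute) auto
  also have "(\<Sum>u\<in>?V. gpn_between ?G u u) = (\<Sum>u\<in>?V. 1)"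
    by (intro sum.cong refl) (auto simp: gpn_between_grid_graph ndist_def)
  \<comment> \<open>Each diagonal term is 1, so \<open>r * s\<close> is subtracted from the ordered
    sum, while twice the vertex count adds \<open>2 * (r * s)\<close>.\<close>
  finally have "2 * gpn ?G = (\<Sum>u\<in>?V. \<Sum>v\<in>?V. gpn_between ?G u v) + r * s"
    by (simp add: gpn_def pverts_grid_graph)
  also have "(\<Sum>u\<in>?V. \<Sum>v\<in>?V. gpn_between ?G u v) =
      (\<Sum>a=1..r. \<Sum>b=1..s. \<Sum>x=1..r. \<Sum>y=1..s. (ndist a x + ndist b y) choose ndist a x)"
    unfolding sum.cartesian_product'
    by (intro sum.cong refl) (simp only: gpn_between_grid_graph mem_Sigma_iff simp_thms)
  also have "\<dots> =
      (\<Sum>a=1..r. \<Sum>x=1..r. \<Sum>b=1..s. \<Sum>y=1..s. (ndist a x + ndist b y) choose ndist a x)"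
    by (intro sum.cong refl sum.swap)
  finally have "2 * real (gpn ?G) =
      (\<Sum>a=1..r. \<Sum>x=1..r. \<Sum>b=1..s. \<Sum>y=1..s. real ((ndist a x + ndist b y) choose ndist a x))
        + real (r * s)"
    by (simp flip: of_nat_sum of_nat_mult of_nat_add)
  then show ?thesis unfolding sum_ordered_choose by (simp add: field_simps)
qed

end
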